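(* Consider the flexibility-aware hosting capacity problem for a copperplate network with curtailment flexibility and intervention budget $K$: $$\max_{C,\ \mathbf u} \ C\quad\text{s.t.}\quad \ell^{\mathrm{agg}}(t)+C\,\hat\ell^\dagger(t)+u(t)\le \overline p_0\ \ (t\in\mathcal T),\qquad \mathbf u\in\mathbb R^T,\quad \mathbf u\le \mathbf 0,\quad \|\mathbf u\|_0\le K .$$ The optimal value of this problem is $$C^\star_K=C[K+1].$$ The optimal load modification is $$u^\star(t)=\begin{cases} C^{\mathrm{res}}(t)-C^\star_K\,\hat\ell^\dagger(t), & \text{if } t=t_s,\ s\le K,\\ 0,&\text{otherwise.}\end{cases}$$
   Context: $\mathcal T=\{1,\dots,T\}$ is a finite set of time slots. $\ell^{\mathrm{agg}}(t)$ is the aggregate existing load at time $t$, $\overline p_0$ is the transformer capacity, and $\hat\ell^\dagger(t)$, with $0\le\hat\ell^\dagger(t)\le 1$, is the normalized profile of the new load (a new load of capacity $C$ consumes $C\hat\ell^\dagger(t)$ at time $t$ before modification by $u(t)$). $\|\mathbf u\|_0$ denotes the number of nonzero entries of $\mathbf u$. The copperplate network has only the transformer capacity constraint (no voltage constraints). Dynamic residual capacity and dynamic hosting capacity for time $t$: $C^{\mathrm{res}}(t):=\overline p_0-\ell^{\mathrm{agg}}(t)$ and $C(t):=C^{\mathrm{res}}(t)/\hat\ell^\dagger(t)$. Order statistics: $C[s]$ is the $s$-th (lower) order statistic of $\{C(t):t\in\mathcal T\}$ and $t_s$ is the corresponding time index, i.e. $C[s]=C(t_s)$ for $s\in\mathcal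 T$ and $C[s]\le C[s+1]$ for $s\in\mathcal T\setminus\{T\}$. *)

theory Defs
  imports Complex_Main "HOL-Library.Extended_Real" "HOL-Library.Multiset"
begin

definition res_capacity :: "real \<Rightarrow> (nat \<Rightarrow> real) \<Rightarrow> nat \<Rightarrow> real" where
  "res_capacity p0 lagg t = p0 - lagg t"

text \<open>The quotient of the residual capacity and the load profile, read in the extended reals because
  the profile may vanish. A slot with zero profile does not limit the new load at all if its residual
  capacity is nonnegative (value \<open>\<infinity>\<close>, which also fixes \<open>0 / 0\<close>), and admits no new load
  whatsoever, not even a negative one, if its residual capacity is negative (value \<open>-\<infinity>\<close>).\<close>

definition hosting_capacity ::
    "real \<Rightarrow> (nat \<Rightarrow> real) \<Rightarrow> (nat \<Rightarrow> real) \<Rightarrow> nat \<Rightarrow> ereal" where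
  "hosting_capacity p0 lagg lhat t =
     (if lhat t \<noteq> 0 then ereal (res_capacity p0 lagg t / lhat t)
      else if 0 \<le> res_capacity p0 lagg t then \<infinity> else -\<infinity>)"

text \<open>Order statistics of a family indexed by \<open>1, \<dots>, T\<close>, counted with multiplicity; the
  rank \<open>s\<close> also ranges over \<open>1, \<dots>, T\<close>, whereas list positions start at \<open>0\<close>.\<close>

definition order_stat :: "nat \<Rightarrow> (nat \<Rightarrow> 'a::linorder) \<Rightarrow> nat \<Rightarrow> 'a" where
  "order_stat T f s = sort (map f [1..<Suc T]) ! (s - 1)"

text \<open>With ties the indices belonging to the order statistics are not unique, so they are described
  by a predicate.\<close>

definition order_indices :: "nat \<Rightarrow> (nat \<Rightarrow> 'a::linorder) \<Rightarrow> (nat \<Rightarrow> nat) \<Rightarrow> bool" where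
  "order_indices T f \<tau> \<longleftrightarrow>
     bij_betw \<tau> {1..T} {1..T} \<and> (\<forall>s\<in>{1..T}. order_stat T f s = f (\<tau> s))"

lemma order_stat_mono:
  assumes "1 \<le> s" "s < T"
  shows "order_stat T f s \<le> order_stat T f (Suc s)"
  unfolding order_stat_def using assms by (intro sorted_nth_mono) auto

lemma ex_order_indices: "\<exists>\<tau>. order_indices T f \<tau>"
proof -
  define xs where "xs = sort_key f [1..<Suc T]"
  have len: "length xs = T" by (simp add: xs_def)
  have eq: "sort (map f [1..<Suc T]) = map f xs"
    by (rule properties_for_sort) (simp_all add: xs_def)
  have "bij_betw ((!) xs) {..<length xs} (set xs)"
    by (rule bij_betw_nth) (simp_all add: xs_def)
  moreover have "bij_betw (\<lambda>s. s - 1) {1..T} {..<T}"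
    by (rule bij_betw_byWitness[where f' = Suc]) auto
  moreover have "set xs = {1..T}" by (auto simp: xs_def)
  ultimately have "bij_betw ((!) xs \<circ> (\<lambda>s. s - 1)) {1..T} {1..T}"
    using len by (metis bij_betw_trans)
  moreover have "order_stat T f s = f (((!) xs \<circ> (\<lambda>s. s - 1)) s)" if "s \<in> {1..T}" for s
    using that len unfolding order_stat_def eq by auto
  ultimately show ?thesis unfolding order_indices_def by blast
qed

text \<open>A vector of length \<open>T\<close> is a function on \<open>nat\<close>, of which only the
  values on \<open>{1..T}\<close> are ever used.\<close>

definition l0_norm :: "nat \<Rightarrow> (nat \<Rightarrow> real) \<Rightarrow> nat" where
  "l0_norm T u = card {t \<in> {1..T}. u t \<noteq> 0}"

definition feasible ::
    "nat \<Rightarrow> real \<Rightarrow> (nat \<Rightarrow> real) \<Rightarrow> (nat \<Rightarrow> real) \<Rightarrow> nat \<Rightarrow> real \<Rightarrow> (nat \<Rightarrow> real) \<Rightarrow> bool" where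
  "feasible T p0 lagg lhat K C u \<longleftrightarrow>
     (\<forall>t\<in>{1..T}. lagg t + C * lhat t + u t \<le> p0) \<and>
     (\<forall>t\<in>{1..T}. u t \<le> 0) \<and> l0_norm T u \<le> K"

definition optimal_value ::
    "nat \<Rightarrow> real \<Rightarrow> (nat \<Rightarrow> real) \<Rightarrow> (nat \<Rightarrow> real) \<Rightarrow> nat \<Rightarrow> ereal" where
  "optimal_value T p0 lagg lhat K = Sup {ereal C | C. \<exists>u. feasible T p0 lagg lhat K C u}"

definition optimal_solution ::
    "nat \<Rightarrow> real \<Rightarrow> (nat \<Rightarrow> real) \<Rightarrow> (nat \<Rightarrow> real) \<Rightarrow> nat \<Rightarrow> real \<Rightarrow> (nat \<Rightarrow> real) \<Rightarrow> bool" where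
  "optimal_solution T p0 lagg lhat K C u \<longleftrightarrow>
     feasible T p0 lagg lhat K C u \<and>
     (\<forall>C' u'. feasible T p0 lagg lhat K C' u' \<longrightarrow> C' \<le> C)"

definition load_modification ::
    "nat \<Rightarrow> real \<Rightarrow> (nat \<Rightarrow> real) \<Rightarrow> (nat \<Rightarrow> real) \<Rightarrow> nat \<Rightarrow> (nat \<Rightarrow> nat) \<Rightarrow> real \<Rightarrow> nat \<Rightarrow> real" where
  "load_modification T p0 lagg lhat K \<tau> C t =
     (if \<exists>s\<in>{1..T}. s \<le> K \<and> t = \<tau> s then res_capacity p0 lagg t - C * lhat t else 0)"

lemma order_stat_hosting_capacity_finite:
  assumes "\<And>t. t \<in> {1..T} \<Longrightarrow> 0 < lhat t" and "s \<in> {1..T}"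
  shows "\<bar>order_stat T (hosting_capacity p0 lagg lhat) s\<bar> \<noteq> \<infinity>"
proof -
  obtain \<tau> where \<tau>: "order_indices T (hosting_capacity p0 lagg lhat) \<tau>"
    using ex_order_indices by blast
  then have "\<tau> s \<in> {1..T}"
    using assms(2) by (auto simp: order_indices_def dest: bij_betwE)
  then have "lhat (\<tau> s) \<noteq> 0" using assms(1) by force
  then show ?thesis
    using \<tau> assms(2) by (simp add: order_indices_def hosting_capacity_def)
qed

end

theory Submission
  imports Defs
begin

text \<open>A slot left untouched by \<open>u\<close> admits the new load \<open>C\<close> exactly if \<open>C \<le> C(t)\<close>, so the
  slots that must be modified are those with \<open>C(t) < C\<close>. There are at most \<open>K\<close> of them iff
  \<open>C \<le> C[K+1]\<close>: otherwise \<open>t\<^sub>1, \<dots>, t\<^bsub>K+1\<^esub>\<close> all need a modification.\<close>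

lemma order_stat_le:
  assumes "1 \<le> s" "s \<le> s'" "s' \<le> T"
  shows "order_stat T f s \<le> order_stat T f s'"
  unfolding order_stat_def using assms by (intro sorted_nth_mono) auto

text \<open>At a zero profile both sides say that the residual capacity is nonnegative; the infinite
  values of \<open>hosting_capacity\<close> are chosen to this end.\<close>

lemma le_hosting_capacity_iff:
  assumes "0 \<le> lhat t"
  shows "ereal C \<le> hosting_capacity p0 lagg lhat t \<longleftrightarrow> C * lhat t \<le> res_capacity p0 lagg t"
  using assms by (auto simp: hosting_capacity_def pos_le_divide_eq)

text \<open>At a zero profile the bound by a real forces the value minus infinity, so the residual
  capacity is negative. The converse fails when profile and residual capacity both vanish.\<close>

lemma hosting_capacity_le_imp:
  assumes "0 \<le> lhat t" "hosting_capacity p0 lagg lhat t \<le> ereal C"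
  shows "res_capacity p0 lagg t \<le> C * lhat t"
  using assms by (auto simp: hosting_capacity_def pos_divide_le_eq split: if_splits)

lemma feasible_le_order_stat:
  assumes nonneg: "\<And>t. t \<in> {1..T} \<Longrightarrow> 0 \<le> lhat t"
    and "K < T"
    and feas: "feasible T p0 lagg lhat K C u"
  shows "ereal C \<le> order_stat T (hosting_capacity p0 lagg lhat) (K + 1)"
proof -
  let ?h = "hosting_capacity p0 lagg lhat"
  obtain \<tau> where \<tau>: "order_indices T ?h \<tau>"
    using ex_order_indices by blast
  then have bij: "bij_betw \<tau> {1..T} {1..T}"
    by (simp add: order_indices_def)
  have sub: "{1..K+1} \<subseteq> {1..T}" using \<open>K < T\<close> by auto
  have "card (\<tau> ` {1..K+1}) = K + 1"
    using inj_on_subset[OF bij_betw_imp_inj_on[OF bij] sub] by (simp add: card_image)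
  moreover have "card {t \<in> {1..T}. u t \<noteq> 0} \<le> K"
    using feas by (simp add: feasible_def l0_norm_def)
  \<comment> \<open>Pigeonhole: at most \<open>K\<close> slots are modified, so one of the
    \<open>K + 1\<close> slots of lowest rank is untouched, and its own capacity bounds
    \<open>C\<close>.\<close>
  ultimately have "\<not> \<tau> ` {1..K+1} \<subseteq> {t \<in> {1..T}. u t \<noteq> 0}"
    using card_mono[of "{t \<in> {1..T}. u t \<noteq> 0}" "\<tau> ` {1..K+1}"] by force
  then obtain s where s: "s \<in> {1..K+1}" "\<tau> s \<in> {1..T}" "u (\<tau> s) = 0"
    using bij_betwE[OF bij] sub by blast
  have "lagg (\<tau> s) + C * lhat (\<tau> s) + u (\<tau> s) \<le> p0"
    using feas s(2) unfolding feasible_def by blast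
  then have "ereal C \<le> ?h (\<tau> s)"
    using s(3) nonneg[OF s(2)] by (simp add: le_hosting_capacity_iff res_capacity_def)
  also have "\<dots> = order_stat T ?h s"
    using \<tau> s(1) \<open>K < T\<close> by (simp add: order_indices_def)
  also have "\<dots> \<le> order_stat T ?h (K + 1)"
    using s(1) \<open>K < T\<close> by (intro order_stat_le) auto
  finally show ?thesis .
qed

text \<open>For \<open>C < C[K+1]\<close> the load modification itself may be positive, hence the truncation at \<open>0\<close>.\<close>

lemma feasible_min_load_modification:
  assumes nonneg: "\<And>t. t \<in> {1..T} \<Longrightarrow> 0 \<le> lhat t"
    and "K < T"
    and \<tau>: "order_indices T (hosting_capacity p0 lagg lhat) \<tau>"
    and C: "ereal C \<le> order_stat T (hosting_capacity p0 lagg lhat) (K + 1)"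
  shows "feasible T p0 lagg lhat K C (\<lambda>t. min 0 (load_modification T p0 lagg lhat K \<tau> C t))"
    (is "feasible _ _ _ _ _ _ ?u")
  unfolding feasible_def
proof (intro conjI ballI)
  let ?h = "hosting_capacity p0 lagg lhat"
  have bij: "bij_betw \<tau> {1..T} {1..T}"
    using \<tau> by (simp add: order_indices_def)
  fix t assume t: "t \<in> {1..T}"
  show "lagg t + C * lhat t + ?u t \<le> p0"
  proof (cases "\<exists>s\<in>{1..T}. s \<le> K \<and> t = \<tau> s")
    case True
    then show ?thesis by (simp add: load_modification_def res_capacity_def)
  next
    case False
    \<comment> \<open>Every slot has a rank; an untouched one has rank at least
      \<open>K + 1\<close>, so its capacity is at least \<open>C[K+1]\<close>.\<close>
    obtain s where s: "s \<in> {1..T}" "t = \<tau> s"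
      using t bij_betw_imp_surj_on[OF bij] by blast
    have "K + 1 \<le> s"
      using False s by (metis not_less_eq_eq Suc_eq_plus1)
    then have "ereal C \<le> order_stat T ?h s"
      using s(1) by (intro order_trans[OF C] order_stat_le) auto
    then have "ereal C \<le> ?h t"
      using \<tau> s by (simp add: order_indices_def)
    then show ?thesis
      using False nonneg[OF t]
      by (auto simp: le_hosting_capacity_iff load_modification_def res_capacity_def)
  qed
next
  show "l0_norm T ?u \<le> K"
  proof -
    have "{t \<in> {1..T}. ?u t \<noteq> 0} \<subseteq> \<tau> ` {1..K}"
      by (auto simp: load_modification_def split: if_splits)
    then have "card {t \<in> {1..T}. ?u t \<noteq> 0} \<le> card {1..K}"
      by (intro surj_card_le) auto
    then show ?thesis by (simp add: l0_norm_def)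
  qed
qed simp

text \<open>The slots of rank at most \<open>K\<close> have capacity at most \<open>C[K+1]\<close>,
  hence at most \<open>C\<close>, so the load \<open>C\<close> uses up their residual capacity. From
  \<open>C[K+1]\<close> on, the truncation is therefore void.\<close>

lemma load_modification_nonpos:
  assumes nonneg: "\<And>t. t \<in> {1..T} \<Longrightarrow> 0 \<le> lhat t"
    and "K < T"
    and \<tau>: "order_indices T (hosting_capacity p0 lagg lhat) \<tau>"
    and C: "order_stat T (hosting_capacity p0 lagg lhat) (K + 1) \<le> ereal C"
  shows "load_modification T p0 lagg lhat K \<tau> C t \<le> 0"
proof (cases "\<exists>s\<in>{1..T}. s \<le> K \<and> t = \<tau> s")
  case True
  let ?h = "hosting_capacity p0 lagg lhat"
  from True obtain s where s: "s \<in> {1..T}" "s \<le> K" "t = \<tau> s" by blast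
  have t: "t \<in> {1..T}"
    using \<tau> s by (auto simp: order_indices_def dest: bij_betwE)
  have "?h t = order_stat T ?h s"
    using \<tau> s by (simp add: order_indices_def)
  also have "\<dots> \<le> order_stat T ?h (K + 1)"
    using s \<open>K < T\<close> by (intro order_stat_le) auto
  finally have "?h t \<le> ereal C" using C by order
  then have "res_capacity p0 lagg t \<le> C * lhat t"
    using nonneg[OF t] by (intro hosting_capacity_le_imp)
  then show ?thesis by (simp add: load_modification_def)
qed (auto simp: load_modification_def)

text \<open>The reals are dense in the extended reals. This covers infinite \<open>x\<close> too:
  for minus infinity the set is empty.\<close>

lemma ereal_Sup_real_below: "Sup {ereal r | r. ereal r \<le> x} = x"
proof (rule antisym)
  show "x \<le> Sup {ereal r | r. ereal r \<le> x}"
  proof (rule dense_le)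
    fix y assume "y < x"
    then obtain r where "y < ereal r" "ereal r < x"
      by (blast dest: ereal_dense2)
    then show "y \<le> Sup {ereal r | r. ereal r \<le> x}"
      by (intro Sup_upper2[of "ereal r"]) auto
  qed
qed (auto intro: Sup_least)

text \<open>\<open>K < T\<close> makes rank \<open>K + 1\<close> exist. If \<open>Cstar\<close> is
  infinite, the problem is unbounded or infeasible and has no optimal solution. Under ties, every
  choice of \<open>\<tau>\<close> is covered.\<close>

theorem proposition1:
  fixes T K :: nat and p0 :: real and lagg lhat :: "nat \<Rightarrow> real"
  assumes profile: "\<And>t. t \<in> {1..T} \<Longrightarrow> 0 \<le> lhat t \<and> lhat t \<le> 1"
    and budget: "K < T"
  shows "let Cstar = order_stat T (hosting_capacity p0 lagg lhat) (K + 1) in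
    optimal_value T p0 lagg lhat K = Cstar \<and>
    (\<bar>Cstar\<bar> \<noteq> \<infinity> \<longrightarrow>
      (\<forall>\<tau>. order_indices T (hosting_capacity p0 lagg lhat) \<tau> \<longrightarrow>
        optimal_solution T p0 lagg lhat K (real_of_ereal Cstar)
          (load_modification T p0 lagg lhat K \<tau> (real_of_ereal Cstar))))"
proof -
  define Cs where "Cs = order_stat T (hosting_capacity p0 lagg lhat) (K + 1)"
  have nonneg: "0 \<le> lhat t" if "t \<in> {1..T}" for t
    using profile[OF that] by simp
  have upper: "ereal C \<le> Cs" if "feasible T p0 lagg lhat K C u" for C u
    unfolding Cs_def using nonneg budget that by (rule feasible_le_order_stat)
  have min_feasible: "feasible T p0 lagg lhat K C (\<lambda>t. min 0 (load_modification T p0 lagg lhat K \<tau> C t))"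
    if "order_indices T (hosting_capacity p0 lagg lhat) \<tau>" "ereal C \<le> Cs" for C \<tau>
    using nonneg budget that(1) that(2)[unfolded Cs_def] by (rule feasible_min_load_modification)
  have "(\<exists>u. feasible T p0 lagg lhat K C u) \<longleftrightarrow> ereal C \<le> Cs" for C
    using upper min_feasible ex_order_indices by blast
  then have value_eq: "optimal_value T p0 lagg lhat K = Cs"
    by (simp add: optimal_value_def ereal_Sup_real_below)
  have solution: "optimal_solution T p0 lagg lhat K (real_of_ereal Cs)
      (load_modification T p0 lagg lhat K \<tau> (real_of_ereal Cs))"
    if fin: "\<bar>Cs\<bar> \<noteq> \<infinity>" and \<tau>: "order_indices T (hosting_capacity p0 lagg lhat) \<tau>" for \<tau>
  proof -
    obtain C where C: "Cs = ereal C" using fin by (cases Cs) auto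
    have "load_modification T p0 lagg lhat K \<tau> C t \<le> 0" for t
      using nonneg budget \<tau> C by (intro load_modification_nonpos) (simp_all add: Cs_def)
    \<comment> \<open>At \<open>C = C[K+1]\<close> the truncated modification is the stated one, so
      it inherits feasibility.\<close>
    then have "(\<lambda>t. min 0 (load_modification T p0 lagg lhat K \<tau> C t)) =
        load_modification T p0 lagg lhat K \<tau> C"
      by (simp add: min_absorb2)
    with min_feasible[OF \<tau>, of C] C
    have "feasible T p0 lagg lhat K C (load_modification T p0 lagg lhat K \<tau> C)"
      by simp
    then show ?thesis
      using upper C by (auto simp: optimal_solution_def)
  qed
  show ?thesis
    unfolding Let_def Cs_def[symmetric] by (intro conjI impI allI value_eq solution)
qed

end
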